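(* Let $E$ be a locally convex vector space whose topology is generated by an increasing sequence of seminorms $(p_n)_{n\in\mathbb N}$. Let $A\subseteq\mathcal G_E$ be internal and non-empty and suppose that $A$ has a sharply bounded representative $(A_\varepsilon)_\varepsilon$. Let $B=[(B_\varepsilon)_\varepsilon]\subseteq\mathcal G_E$ be internal. For $n\in\mathbb N$ and $\varepsilon\in(0,1)$ put $\delta_{n,\varepsilon}:=\sup_{u\in A_\varepsilon}d_n(u,B_\varepsilon)$. Then $$A\subseteq B\iff(\forall n\in\mathbb N)\ \big((\delta_{n,\varepsilon})_\varepsilon\in\mathcal N\big).$$ This characterization is valid for every choice of the sharply bounded representative $(A_\varepsilon)_\varepsilon$ of $A$ and of the representative $(B_\varepsilon)_\varepsilon$ of $B$. Further, if $A\subseteq B$, then there exists a net $(n_\varepsilon)_\varepsilon\in\mathbb N^{(0,1)}$ with $\lim_{\varepsilon\to0}n_\varepsilon=+\infty$ such that $(\delta_{n_\varepsilon,\varepsilon})_\varepsilon\in\mathcal N$ and such that for any negligible net $(\nu_\varepsilon)_\varepsilon\in\mathbb R^{(0,1)}$ with $\nu_\varepsilon>0$ for all $\varepsilon$, we have $A=[(\widetilde A_\varepsilon)_\varepsilon]$ with $$\widetilde A_\varepsilon=\{u\in E: d_{n_\varepsilon}(u,A_\varepsilon)\le\delta_{n_\varepsilon,\varepsilon}+\nu_\varepsilon\}\cap B_\varepsilon\quad\text{for all }\varepsilon.$$ In particular, if $A\subseteq B$, then for each representative $(B_\varepsilon)_\varepsilon$ of $B$ there exists a sharply bounded representative $(\widetilde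 A_\varepsilon)_\varepsilon$ of $A$ such that $\widetilde A_\varepsilon\subseteq B_\varepsilon$ for all $\varepsilon$.
   Context: For a locally convex space $E$ with topology generated by seminorms $(p_i)_{i\in I}$: a net $(u_\varepsilon)_\varepsilon\in E^{(0,1)}$ is moderate if for each $i\in I$ there are $M\in\mathbb N$ and $\eta\in(0,1)$ with $p_i(u_\varepsilon)\le\varepsilon^{-M}$ for all $\varepsilon\le\eta$; it is negligible if for each $i\in I$ and each $m\in\mathbb N$ there is $\eta\in(0,1)$ with $p_i(u_\varepsilon)\le\varepsilon^m$ for all $\varepsilon\le\eta$. The Colombeau space based on $E$ is the quotient $\mathcal G_E$ of the moderate nets by the negligible nets; a net in the class $u\in\mathcal G_E$ is called a representative of $u$. $\mathcal N$ denotes the negligible nets of real numbers, i.e. $(x_\varepsilon)_\varepsilon$ such that for each $m\in\mathbb N$ there is $\eta\in(0,1)$ with $|x_\varepsilon|\le\varepsilon^m$ for all $\varepsilon\le\eta$ (values for large $\varepsilon$ are irrelevant and may be $+\infty$). For $C\subseteq E$ and $u\in E$, $d_n(u,C)=\inf_{v\in C}p_n(u-v)\in[0,+\infty]$, with $\inf\emptyset=+\infty$; suprema of sets of distances are taken in $[0,+\infty]$. A subset $A\subseteq\mathcal G_E$ is internal if there is a net $(A_\varepsilon)_{\varepsilon\in(0,1)}$ of subsets of $E$ (called a representative of $A$) such that $A=[(A_\varepsilon)_\varepsilon]$, the set of all $u\in\mathcal G_E$ for which there exist a representative $(u_\varepsilon)_\varepsilon$ of $u$ and $\eta>0$ such that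 $u_\varepsilon\in A_\varepsilon$ for all $\varepsilon<\eta$. A net $(A_\varepsilon)_\varepsilon$ of subsets of $E$ is sharply bounded if for each $i\in I$ there are $M\in\mathbb N$ and $\varepsilon_0\in(0,1)$ such that $p_i(u)\le\varepsilon^{-M}$ for all $\varepsilon\le\varepsilon_0$ and all $u\in A_\varepsilon$. *)

theory Defs
  imports "HOL-Analysis.Analysis"
begin

text \<open>
  A locally convex space is given by a real vector space together with a family of seminorms
  generating its topology; everything below depends only on that family. No Hausdorff condition
  is imposed. A complex locally convex space is covered by restriction of scalars.
\<close>

definition seminorm :: "('a::real_vector \<Rightarrow> real) \<Rightarrow> bool" where
  "seminorm q \<longleftrightarrow>
     (\<forall>x. 0 \<le> q x) \<and> (\<forall>x y. q (x + y) \<le> q x + q y) \<and> (\<forall>c x. q (c *\<^sub>R x) = \<bar>c\<bar> * q x)"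

text \<open>
  A net indexed by the interval \<open>(0,1)\<close> is a function on all reals whose values outside \<open>(0,1)\<close>
  are never inspected. Two such functions agreeing on \<open>(0,1)\<close> are identified in the Colombeau
  space, so it is the same quotient as the one of nets defined on \<open>(0,1)\<close> only.
\<close>

type_synonym 'a net = "real \<Rightarrow> 'a"

definition moderate :: "('i \<Rightarrow> 'a::real_vector \<Rightarrow> real) \<Rightarrow> 'a net \<Rightarrow> bool" where
  "moderate p u \<longleftrightarrow>
     (\<forall>i. \<exists>M::nat. \<exists>\<eta>\<in>{0<..<1}. \<forall>\<epsilon>\<in>{0<..\<eta>}. p i (u \<epsilon>) \<le> \<epsilon> powi (- int M))"

definition negligible_net :: "('i \<Rightarrow> 'a::real_vector \<Rightarrow> real) \<Rightarrow> 'a net \<Rightarrow> bool" where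
  "negligible_net p u \<longleftrightarrow>
     (\<forall>i. \<forall>m::nat. \<exists>\<eta>\<in>{0<..<1}. \<forall>\<epsilon>\<in>{0<..\<eta>}. p i (u \<epsilon>) \<le> \<epsilon> ^ m)"

definition colombeau_rel :: "('i \<Rightarrow> 'a::real_vector \<Rightarrow> real) \<Rightarrow> ('a net \<times> 'a net) set" where
  "colombeau_rel p =
     {(u, v). moderate p u \<and> moderate p v \<and> negligible_net p (\<lambda>\<epsilon>. u \<epsilon> - v \<epsilon>)}"

definition colombeau :: "('i \<Rightarrow> 'a::real_vector \<Rightarrow> real) \<Rightarrow> 'a net set set" where
  "colombeau p = {u. moderate p u} // colombeau_rel p"

text \<open>The representatives of a generalized point are the elements of the equivalence class.\<close>

definition internal_set ::
    "('i \<Rightarrow> 'a::real_vector \<Rightarrow> real) \<Rightarrow> 'a set net \<Rightarrow> 'a net set set" where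
  "internal_set p A =
     {U \<in> colombeau p. \<exists>u\<in>U. \<exists>\<eta>>0. \<forall>\<epsilon>\<in>{0<..<1}. \<epsilon> < \<eta> \<longrightarrow> u \<epsilon> \<in> A \<epsilon>}"

definition internal :: "('i \<Rightarrow> 'a::real_vector \<Rightarrow> real) \<Rightarrow> 'a net set set \<Rightarrow> bool" where
  "internal p \<A> \<longleftrightarrow> \<A> \<subseteq> colombeau p \<and> (\<exists>A. \<A> = internal_set p A)"

definition sharply_bounded ::
    "('i \<Rightarrow> 'a::real_vector \<Rightarrow> real) \<Rightarrow> 'a set net \<Rightarrow> bool" where
  "sharply_bounded p A \<longleftrightarrow>
     (\<forall>i. \<exists>M::nat. \<exists>\<epsilon>\<^sub>0\<in>{0<..<1}. \<forall>\<epsilon>\<in>{0<..\<epsilon>\<^sub>0}. \<forall>u\<in>A \<epsilon>. p i u \<le> \<epsilon> powi (- int M))"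

text \<open>The class \<open>\<N>\<close> of negligible scalar nets, which may take infinite values.\<close>

definition negligible_scalar :: "ereal net \<Rightarrow> bool" where
  "negligible_scalar x \<longleftrightarrow>
     (\<forall>m::nat. \<exists>\<eta>\<in>{0<..<1}. \<forall>\<epsilon>\<in>{0<..\<eta>}. \<bar>x \<epsilon>\<bar> \<le> ereal (\<epsilon> ^ m))"

text \<open>
  Distances live in \<^typ>\<open>ennreal\<close>, where the infimum of the empty set is \<open>\<infinity>\<close> and the supremum of
  the empty set is \<open>0\<close>. The coercion \<^const>\<open>ennreal\<close> truncates negative reals, but seminorms are
  nonnegative.
\<close>

definition seminorm_dist ::
    "('i \<Rightarrow> 'a::real_vector \<Rightarrow> real) \<Rightarrow> 'i \<Rightarrow> 'a \<Rightarrow> 'a set \<Rightarrow> ennreal" where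
  "seminorm_dist p n u C = (INF v\<in>C. ennreal (p n (u - v)))"

definition excess ::
    "('i \<Rightarrow> 'a::real_vector \<Rightarrow> real) \<Rightarrow> 'a set net \<Rightarrow> 'a set net \<Rightarrow> 'i \<Rightarrow> real \<Rightarrow> ennreal" where
  "excess p A B n \<epsilon> = (SUP u\<in>A \<epsilon>. seminorm_dist p n u (B \<epsilon>))"

end

theory Submission
  imports Defs
begin

text \<open>
  Everything is a statement about the germ of nets at \<open>\<epsilon> \<rightarrow> 0+\<close>, so all definitions are first
  rewritten in terms of the filter \<^term>\<open>at_right (0::real)\<close>. Two ideas then carry the proof.

  Worst points: if \<open>\<A> \<subseteq> \<B>\<close>, choose \<open>u\<^sub>\<epsilon> \<in> A\<^sub>\<epsilon>\<close> whose distance to \<open>B\<^sub>\<epsilon>\<close> exceeds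
  \<open>\<epsilon>\<^sup>m\<close> whenever some point of \<open>A\<^sub>\<epsilon>\<close> has this property. Sharp boundedness makes
  the net moderate, so its class lies in \<open>\<A>\<close>, hence in \<open>\<B>\<close>, and being negligibly close to a net in
  \<open>B\<^sub>\<epsilon>\<close> it shows that eventually no such point exists
  (\<open>negligible_excess_if_internal_subset\<close>).

  Diagonalization: a sequence of negligible nets \<open>\<delta>\<^sub>n\<close> admits indices \<open>N\<^sub>\<epsilon> \<rightarrow> \<infinity>\<close> with
  \<open>\<delta>\<close> still negligible along \<open>N\<^sub>\<epsilon>\<close> (\<open>ex_diagonal_index\<close>). As the seminorms increase,
  closeness in the single seminorm \<open>p\<close> of index \<open>N\<^sub>\<epsilon>\<close> at each \<open>\<epsilon>\<close> is closeness in all of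
  them, so points of one net of sets may be replaced by nearby points of another net without leaving
  their generalized points (\<open>internal_set_mono_approx\<close>). Applied to \<open>A\<close> and \<open>B\<close> this gives the
  converse implication; applied in both directions to \<open>A\<close> and the part of \<open>B\<close> that is close to
  \<open>A\<close> it gives the new representative, which inherits the bounds of \<open>A\<close>.
\<close>

section \<open>Nets as germs at zero\<close>

lemma eventually_at_right_0_iff:
  "eventually P (at_right (0::real)) \<longleftrightarrow> (\<exists>\<eta>\<in>{0<..<1}. \<forall>\<epsilon>\<in>{0<..\<eta>}. P \<epsilon>)"
proof
  assume "eventually P (at_right (0::real))"
  then obtain b where b: "b > 0" "\<forall>y>0. y < b \<longrightarrow> P y"
    by (auto simp: eventually_at_right_field)
  show "\<exists>\<eta>\<in>{0<..<1}. \<forall>\<epsilon>\<in>{0<..\<eta>}. P \<epsilon>"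
    by (rule bexI[of _ "min (b/2) (1/2)"]) (use b in auto)
next
  assume "\<exists>\<eta>\<in>{0<..<1}. \<forall>\<epsilon>\<in>{0<..\<eta>}. P \<epsilon>"
  then show "eventually P (at_right (0::real))"
    by (auto simp: eventually_at_right_field intro: less_imp_le)
qed

lemma eventually_at_right_0_open_iff:
  "eventually P (at_right (0::real)) \<longleftrightarrow> (\<exists>\<eta>>0. \<forall>\<epsilon>\<in>{0<..<1}. \<epsilon> < \<eta> \<longrightarrow> P \<epsilon>)"
proof
  assume "eventually P (at_right (0::real))"
  then show "\<exists>\<eta>>0. \<forall>\<epsilon>\<in>{0<..<1}. \<epsilon> < \<eta> \<longrightarrow> P \<epsilon>"
    by (auto simp: eventually_at_right_field)
next
  assume "\<exists>\<eta>>0. \<forall>\<epsilon>\<in>{0<..<1}. \<epsilon> < \<eta> \<longrightarrow> P \<epsilon>"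
  then obtain \<eta> where "\<eta> > 0" "\<forall>\<epsilon>\<in>{0<..<1}. \<epsilon> < \<eta> \<longrightarrow> P \<epsilon>" by blast
  then show "eventually P (at_right (0::real))"
    unfolding eventually_at_right_field by (intro exI[of _ "min \<eta> 1"]) auto
qed

lemma eventually_small:
  "c > 0 \<Longrightarrow> \<forall>\<^sub>F \<epsilon> in at_right (0::real). 0 < \<epsilon> \<and> \<epsilon> < c"
  by (auto simp: eventually_at_right_field)

lemma moderate_iff:
  "moderate p u \<longleftrightarrow> (\<forall>i. \<exists>M. \<forall>\<^sub>F \<epsilon> in at_right 0. p i (u \<epsilon>) \<le> \<epsilon> powi (- int M))"
  by (simp add: moderate_def eventually_at_right_0_iff)

lemma negligible_net_iff:
  "negligible_net p u \<longleftrightarrow> (\<forall>i m. \<forall>\<^sub>F \<epsilon> in at_right 0. p i (u \<epsilon>) \<le> \<epsilon> ^ m)"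
  by (simp add: negligible_net_def eventually_at_right_0_iff)

lemma sharply_bounded_iff:
  "sharply_bounded p A \<longleftrightarrow>
     (\<forall>i. \<exists>M. \<forall>\<^sub>F \<epsilon> in at_right 0. \<forall>u\<in>A \<epsilon>. p i u \<le> \<epsilon> powi (- int M))"
  by (simp add: sharply_bounded_def eventually_at_right_0_iff)

lemma mem_internal_set_iff:
  "U \<in> internal_set p A \<longleftrightarrow> U \<in> colombeau p \<and> (\<exists>u\<in>U. \<forall>\<^sub>F \<epsilon> in at_right 0. u \<epsilon> \<in> A \<epsilon>)"
  by (simp add: internal_set_def eventually_at_right_0_open_iff)

lemma negligible_scalar_enn2ereal_iff:
  "negligible_scalar (\<lambda>\<epsilon>. enn2ereal (x \<epsilon>)) \<longleftrightarrow>
     (\<forall>m. \<forall>\<^sub>F \<epsilon> in at_right 0. x \<epsilon> \<le> ennreal (\<epsilon> ^ m))"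
proof -
  have "(\<bar>enn2ereal (x \<epsilon>)\<bar> \<le> ereal (\<epsilon> ^ m)) = (x \<epsilon> \<le> ennreal (\<epsilon> ^ m))"
    if "\<epsilon> > 0" for \<epsilon> :: real and m
    using that by (simp add: less_eq_ennreal.rep_eq enn2ereal_ennreal)
  then have "(\<exists>\<eta>\<in>{0<..<1}. \<forall>\<epsilon>\<in>{0<..\<eta>}. \<bar>enn2ereal (x \<epsilon>)\<bar> \<le> ereal (\<epsilon> ^ m)) \<longleftrightarrow>
      (\<exists>\<eta>\<in>{0<..<1}. \<forall>\<epsilon>\<in>{0<..\<eta>}. x \<epsilon> \<le> ennreal (\<epsilon> ^ m))" for m
    by (intro bex_cong ball_cong) auto
  then show ?thesis
    by (simp add: negligible_scalar_def eventually_at_right_0_iff)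
qed

lemma negligible_scalar_ennreal:
  assumes "negligible_scalar (\<lambda>\<epsilon>. ereal (\<nu> \<epsilon>))"
  shows "negligible_scalar (\<lambda>\<epsilon>. enn2ereal (ennreal (\<nu> \<epsilon>)))"
  unfolding negligible_scalar_enn2ereal_iff
proof
  fix m
  have "\<forall>\<^sub>F \<epsilon> in at_right 0. \<bar>ereal (\<nu> \<epsilon>)\<bar> \<le> ereal (\<epsilon> ^ m)"
    using assms by (simp add: negligible_scalar_def eventually_at_right_0_iff)
  then show "\<forall>\<^sub>F \<epsilon> in at_right 0. ennreal (\<nu> \<epsilon>) \<le> ennreal (\<epsilon> ^ m)"
    by eventually_elim (auto intro: ennreal_leI)
qed

section \<open>Sums of negligible and moderate nets\<close>

lemma double_power_Suc_le:
  fixes \<epsilon> :: real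
  assumes "0 < \<epsilon>" "\<epsilon> < 1/2"
  shows "\<epsilon> ^ Suc m + \<epsilon> ^ Suc m \<le> \<epsilon> ^ m"
proof -
  have "2 * \<epsilon> * \<epsilon> ^ m \<le> 1 * \<epsilon> ^ m"
    using assms by (intro mult_right_mono) auto
  then show ?thesis by simp
qed

lemma powi_add_one_le:
  fixes \<epsilon> :: real
  assumes "0 < \<epsilon>" "\<epsilon> < 1/2"
  shows "\<epsilon> powi (- int M) + 1 \<le> \<epsilon> powi (- int (Suc M))"
proof -
  let ?x = "inverse \<epsilon>"
  have x: "2 \<le> ?x" using assms by (simp add: field_simps)
  then have "1 \<le> ?x ^ M" by (intro one_le_power) simp
  moreover have "2 * ?x ^ M \<le> ?x * ?x ^ M"
    using x assms by (intro mult_right_mono) auto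
  ultimately have "?x ^ M + 1 \<le> ?x ^ Suc M" unfolding power_Suc by linarith
  moreover have "\<epsilon> powi (- int k) = ?x ^ k" for k
    by (simp add: power_int_minus power_inverse)
  ultimately show ?thesis by metis
qed

lemma negligible_scalar_add:
  assumes "negligible_scalar (\<lambda>\<epsilon>. enn2ereal (x \<epsilon>))" "negligible_scalar (\<lambda>\<epsilon>. enn2ereal (y \<epsilon>))"
  shows "negligible_scalar (\<lambda>\<epsilon>. enn2ereal (x \<epsilon> + y \<epsilon>))"
  unfolding negligible_scalar_enn2ereal_iff
proof
  fix m
  have "\<forall>\<^sub>F \<epsilon> in at_right 0. x \<epsilon> \<le> ennreal (\<epsilon> ^ Suc m)"
       "\<forall>\<^sub>F \<epsilon> in at_right 0. y \<epsilon> \<le> ennreal (\<epsilon> ^ Suc m)"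
    using assms unfolding negligible_scalar_enn2ereal_iff by blast+
  moreover have "\<forall>\<^sub>F \<epsilon> in at_right (0::real). 0 < \<epsilon> \<and> \<epsilon> < 1/2"
    by (rule eventually_small) simp
  ultimately show "\<forall>\<^sub>F \<epsilon> in at_right 0. x \<epsilon> + y \<epsilon> \<le> ennreal (\<epsilon> ^ m)"
  proof eventually_elim
    case (elim \<epsilon>)
    have "x \<epsilon> + y \<epsilon> \<le> ennreal (\<epsilon> ^ Suc m) + ennreal (\<epsilon> ^ Suc m)"
      using elim by (intro add_mono) auto
    also have "\<dots> = ennreal (\<epsilon> ^ Suc m + \<epsilon> ^ Suc m)"
      using elim by (intro ennreal_plus[symmetric]) auto
    also have "\<dots> \<le> ennreal (\<epsilon> ^ m)"
      using elim by (intro ennreal_leI double_power_Suc_le) auto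
    finally show ?case .
  qed
qed

lemma seminorm_triangle: "seminorm q \<Longrightarrow> q (x + y) \<le> q x + q y"
  by (simp add: seminorm_def)

lemma seminorm_nonneg: "seminorm q \<Longrightarrow> 0 \<le> q x"
  by (simp add: seminorm_def)

lemma seminorm_minus_commute:
  assumes "seminorm q"
  shows "q (x - y) = q (y - x)"
proof -
  have "q ((-1) *\<^sub>R (y - x)) = \<bar>-1\<bar> * q (y - x)"
    using assms unfolding seminorm_def by blast
  then show ?thesis by simp
qed

lemma negligible_net_trans:
  assumes sn: "\<And>i. seminorm (p i)"
    and "negligible_net p (\<lambda>\<epsilon>. u \<epsilon> - v \<epsilon>)" "negligible_net p (\<lambda>\<epsilon>. v \<epsilon> - w \<epsilon>)"
  shows "negligible_net p (\<lambda>\<epsilon>. u \<epsilon> - w \<epsilon>)"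
  unfolding negligible_net_iff
proof (intro allI)
  fix i m
  have "\<forall>\<^sub>F \<epsilon> in at_right 0. p i (u \<epsilon> - v \<epsilon>) \<le> \<epsilon> ^ Suc m"
       "\<forall>\<^sub>F \<epsilon> in at_right 0. p i (v \<epsilon> - w \<epsilon>) \<le> \<epsilon> ^ Suc m"
    using assms(2,3) unfolding negligible_net_iff by blast+
  moreover have "\<forall>\<^sub>F \<epsilon> in at_right (0::real). 0 < \<epsilon> \<and> \<epsilon> < 1/2"
    by (rule eventually_small) simp
  ultimately show "\<forall>\<^sub>F \<epsilon> in at_right 0. p i (u \<epsilon> - w \<epsilon>) \<le> \<epsilon> ^ m"
  proof eventually_elim
    case (elim \<epsilon>)
    have "p i (u \<epsilon> - w \<epsilon>) \<le> p i (u \<epsilon> - v \<epsilon>) + p i (v \<epsilon> - w \<epsilon>)"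
      using seminorm_triangle[OF sn, of i "u \<epsilon> - v \<epsilon>" "v \<epsilon> - w \<epsilon>"] by simp
    with elim double_power_Suc_le[of \<epsilon> m] show ?case by linarith
  qed
qed

lemma moderate_if_negligible_diff:
  assumes sn: "\<And>i. seminorm (p i)"
    and "moderate p u" "negligible_net p (\<lambda>\<epsilon>. u \<epsilon> - v \<epsilon>)"
  shows "moderate p v"
  unfolding moderate_iff
proof
  fix i
  obtain M where "\<forall>\<^sub>F \<epsilon> in at_right 0. p i (u \<epsilon>) \<le> \<epsilon> powi (- int M)"
    using assms(2) unfolding moderate_iff by blast
  moreover have "\<forall>\<^sub>F \<epsilon> in at_right 0. p i (u \<epsilon> - v \<epsilon>) \<le> \<epsilon> ^ 0"
    using assms(3) unfolding negligible_net_iff by blast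
  moreover have "\<forall>\<^sub>F \<epsilon> in at_right (0::real). 0 < \<epsilon> \<and> \<epsilon> < 1/2"
    by (rule eventually_small) simp
  ultimately have "\<forall>\<^sub>F \<epsilon> in at_right 0. p i (v \<epsilon>) \<le> \<epsilon> powi (- int (Suc M))"
  proof eventually_elim
    case (elim \<epsilon>)
    have "p i (v \<epsilon>) \<le> p i (u \<epsilon>) + p i (u \<epsilon> - v \<epsilon>)"
      using seminorm_triangle[OF sn, of i "u \<epsilon>" "v \<epsilon> - u \<epsilon>"]
        seminorm_minus_commute[OF sn, of i "v \<epsilon>" "u \<epsilon>"] by simp
    with elim powi_add_one_le[of \<epsilon> M] show ?case by (simp del: of_nat_Suc)
  qed
  then show "\<exists>M. \<forall>\<^sub>F \<epsilon> in at_right 0. p i (v \<epsilon>) \<le> \<epsilon> powi (- int M)" ..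
qed

section \<open>Representatives of generalized points\<close>

lemma colombeau_memI:
  assumes sn: "\<And>i. seminorm (p i)"
    and U: "U \<in> colombeau p" "u \<in> U" and uv: "negligible_net p (\<lambda>\<epsilon>. u \<epsilon> - v \<epsilon>)"
  shows "v \<in> U"
proof -
  obtain w where w: "U = colombeau_rel p `` {w}"
    using U(1) unfolding colombeau_def by (auto elim: quotientE)
  then have "moderate p w" "moderate p u" "negligible_net p (\<lambda>\<epsilon>. w \<epsilon> - u \<epsilon>)"
    using U(2) by (auto simp: colombeau_rel_def)
  with uv have "moderate p v" "negligible_net p (\<lambda>\<epsilon>. w \<epsilon> - v \<epsilon>)"
    using moderate_if_negligible_diff[of p u v] negligible_net_trans[of p w u v] sn by blast+
  with \<open>moderate p w\<close> w show ?thesis by (simp add: colombeau_rel_def)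
qed

lemma moderate_class:
  assumes sn: "\<And>i. seminorm (p i)" and u: "moderate p u"
  shows "colombeau_rel p `` {u} \<in> colombeau p" "u \<in> colombeau_rel p `` {u}"
proof -
  have "p i 0 = 0" for i
  proof -
    have "p i (0 *\<^sub>R 0) = \<bar>0\<bar> * p i 0"
      using sn unfolding seminorm_def by blast
    then show ?thesis by simp
  qed
  then have "negligible_net p (\<lambda>\<epsilon>. u \<epsilon> - u \<epsilon>)"
    using eventually_small[of 1] by (auto simp: negligible_net_iff elim: eventually_mono)
  with u show "u \<in> colombeau_rel p `` {u}" by (simp add: colombeau_rel_def)
  show "colombeau_rel p `` {u} \<in> colombeau p"
    using u by (simp add: colombeau_def quotientI)
qed

text \<open>
  Sharp boundedness is what turns an arbitrary selection from the sets into a moderate net.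
\<close>

lemma moderate_if_in_sharply_bounded:
  assumes "sharply_bounded p A" and "\<forall>\<^sub>F \<epsilon> in at_right 0. u \<epsilon> \<in> A \<epsilon>"
  shows "moderate p u"
  unfolding moderate_iff
proof
  fix i
  obtain M where "\<forall>\<^sub>F \<epsilon> in at_right 0. \<forall>u\<in>A \<epsilon>. p i u \<le> \<epsilon> powi (- int M)"
    using assms(1) unfolding sharply_bounded_iff by blast
  with assms(2) have "\<forall>\<^sub>F \<epsilon> in at_right 0. p i (u \<epsilon>) \<le> \<epsilon> powi (- int M)"
    by eventually_elim blast
  then show "\<exists>M. \<forall>\<^sub>F \<epsilon> in at_right 0. p i (u \<epsilon>) \<le> \<epsilon> powi (- int M)" ..
qed

section \<open>Diagonal indices\<close>

text \<open>
  The index at \<open>\<epsilon>\<close> is the largest \<open>n\<close> for which \<open>\<delta>\<^sub>n\<close> is already below \<open>\<epsilon>\<^sup>n\<close>; the cutoff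
  \<open>n \<le> 1/\<epsilon>\<close> only makes this maximum exist. Each fixed \<open>k\<close> eventually is a candidate, so the index
  tends to infinity, and the bound \<open>\<epsilon>\<^sup>n\<close> at the chosen index beats every fixed power.
\<close>

lemma ex_diagonal_index:
  fixes \<delta> :: "nat \<Rightarrow> real \<Rightarrow> ennreal"
  assumes "\<And>n. negligible_scalar (\<lambda>\<epsilon>. enn2ereal (\<delta> n \<epsilon>))"
  obtains N :: "nat net" where "filterlim N at_top (at_right 0)"
    and "negligible_scalar (\<lambda>\<epsilon>. enn2ereal (\<delta> (N \<epsilon>) \<epsilon>))"
proof -
  define S where "S \<epsilon> = {n. real n \<le> 1 / \<epsilon> \<and> \<delta> n \<epsilon> \<le> ennreal (\<epsilon> ^ n)}" for \<epsilon>
  define N where "N \<epsilon> = Max (S \<epsilon>)" for \<epsilon>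
  have finS: "finite (S \<epsilon>)" for \<epsilon>
    by (rule finite_subset[of _ "{..nat \<lfloor>1 / \<epsilon>\<rfloor>}"]) (auto simp: S_def le_nat_floor)
  have inS: "\<forall>\<^sub>F \<epsilon> in at_right 0. k \<in> S \<epsilon>" for k
  proof -
    have "\<forall>\<^sub>F \<epsilon> in at_right 0. \<delta> k \<epsilon> \<le> ennreal (\<epsilon> ^ k)"
      using assms unfolding negligible_scalar_enn2ereal_iff by blast
    moreover have "\<forall>\<^sub>F \<epsilon> in at_right 0. 0 < \<epsilon> \<and> \<epsilon> < 1 / (real k + 1)"
      by (rule eventually_small) simp
    ultimately show ?thesis
    proof eventually_elim
      case (elim \<epsilon>)
      then have "\<epsilon> * (real k + 1) < 1"
        by (simp add: pos_less_divide_eq)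
      with elim have "real k \<le> 1 / \<epsilon>" by (simp add: field_simps)
      with elim show ?case by (simp add: S_def)
    qed
  qed
  have ge: "\<forall>\<^sub>F \<epsilon> in at_right 0. k \<le> N \<epsilon>" for k
    using inS[of k] by eventually_elim (simp add: N_def finS)
  have mem: "\<forall>\<^sub>F \<epsilon> in at_right 0. N \<epsilon> \<in> S \<epsilon>"
    using inS[of 0] unfolding N_def by eventually_elim (use finS Max_in in blast)
  show ?thesis
  proof
    show "filterlim N at_top (at_right 0)"
      using ge by (simp add: filterlim_at_top)
    show "negligible_scalar (\<lambda>\<epsilon>. enn2ereal (\<delta> (N \<epsilon>) \<epsilon>))"
      unfolding negligible_scalar_enn2ereal_iff
    proof
      fix m
      have "\<forall>\<^sub>F \<epsilon> in at_right (0::real). 0 < \<epsilon> \<and> \<epsilon> < 1"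
        by (rule eventually_small) simp
      with mem ge[of m] show "\<forall>\<^sub>F \<epsilon> in at_right 0. \<delta> (N \<epsilon>) \<epsilon> \<le> ennreal (\<epsilon> ^ m)"
      proof eventually_elim
        case (elim \<epsilon>)
        then have "\<delta> (N \<epsilon>) \<epsilon> \<le> ennreal (\<epsilon> ^ N \<epsilon>)" by (simp add: S_def)
        also have "\<dots> \<le> ennreal (\<epsilon> ^ m)"
          using elim by (intro ennreal_leI power_decreasing) auto
        finally show ?case .
      qed
    qed
  qed
qed

lemma negligible_scalar_power_index:
  assumes "filterlim N at_top (at_right 0)"
  shows "negligible_scalar (\<lambda>\<epsilon>. ereal (\<epsilon> ^ N \<epsilon>))"
proof -
  have "\<forall>\<^sub>F \<epsilon> in at_right 0. \<bar>ereal (\<epsilon> ^ N \<epsilon>)\<bar> \<le> ereal (\<epsilon> ^ m)" for m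
  proof -
    have "\<forall>\<^sub>F \<epsilon> in at_right 0. m \<le> N \<epsilon>"
      using assms by (simp add: filterlim_at_top)
    moreover have "\<forall>\<^sub>F \<epsilon> in at_right (0::real). 0 < \<epsilon> \<and> \<epsilon> < 1"
      by (rule eventually_small) simp
    ultimately show ?thesis
      by eventually_elim (auto intro: power_decreasing)
  qed
  then show ?thesis by (simp add: negligible_scalar_def eventually_at_right_0_iff)
qed

section \<open>Approximation along a diagonal index\<close>

text \<open>
  For each fixed \<open>n\<close> eventually \<open>n \<le> N\<^sub>\<epsilon>\<close>, so a bound in the moving seminorm dominates the
  fixed one.
\<close>

lemma eventually_le_along_index:
  fixes p :: "nat \<Rightarrow> 'a::real_vector \<Rightarrow> real"
  assumes "incseq p" and N: "filterlim N at_top (at_right 0)"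
    and r: "negligible_scalar (\<lambda>\<epsilon>. enn2ereal (r \<epsilon>))"
  shows "\<forall>\<^sub>F \<epsilon> in at_right 0. \<forall>x. ennreal (p (N \<epsilon>) x) \<le> r \<epsilon> \<longrightarrow> p n x \<le> \<epsilon> ^ m"
proof -
  have "\<forall>\<^sub>F \<epsilon> in at_right 0. n \<le> N \<epsilon>"
    using N by (simp add: filterlim_at_top)
  moreover have "\<forall>\<^sub>F \<epsilon> in at_right 0. r \<epsilon> \<le> ennreal (\<epsilon> ^ m)"
    using r unfolding negligible_scalar_enn2ereal_iff by blast
  moreover have "\<forall>\<^sub>F \<epsilon> in at_right (0::real). 0 < \<epsilon> \<and> \<epsilon> < 1"
    by (rule eventually_small) simp
  ultimately show ?thesis
  proof eventually_elim
    case (elim \<epsilon>)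
    show ?case
    proof (intro allI impI)
      fix x
      assume "ennreal (p (N \<epsilon>) x) \<le> r \<epsilon>"
      with elim have "ennreal (p (N \<epsilon>) x) \<le> ennreal (\<epsilon> ^ m)" by order
      then have "p (N \<epsilon>) x \<le> \<epsilon> ^ m"
        using elim by (simp add: ennreal_le_iff)
      moreover have "p n x \<le> p (N \<epsilon>) x"
        using assms(1) elim by (simp add: incseq_def le_fun_def)
      ultimately show "p n x \<le> \<epsilon> ^ m" by simp
    qed
  qed
qed

text \<open>
  Replacing each \<open>u\<^sub>\<epsilon> \<in> C\<^sub>\<epsilon>\<close> by a point of \<open>D\<^sub>\<epsilon>\<close> at negligible distance
  changes the representative but not its class.
\<close>

lemma internal_set_mono_approx:
  fixes p :: "nat \<Rightarrow> 'a::real_vector \<Rightarrow> real"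
  assumes sn: "\<And>n. seminorm (p n)" and inc: "incseq p"
    and N: "filterlim N at_top (at_right 0)"
    and r: "negligible_scalar (\<lambda>\<epsilon>. enn2ereal (r \<epsilon>))"
    and ex: "\<forall>\<^sub>F \<epsilon> in at_right 0. \<forall>u\<in>C \<epsilon>. \<exists>v\<in>D \<epsilon>. ennreal (p (N \<epsilon>) (u - v)) \<le> r \<epsilon>"
  shows "internal_set p C \<subseteq> internal_set p D"
proof
  fix U
  assume "U \<in> internal_set p C"
  then obtain u where U: "U \<in> colombeau p" "u \<in> U"
    and u: "\<forall>\<^sub>F \<epsilon> in at_right 0. u \<epsilon> \<in> C \<epsilon>"
    by (auto simp: mem_internal_set_iff)
  define v where "v \<epsilon> = (SOME v. v \<in> D \<epsilon> \<and> ennreal (p (N \<epsilon>) (u \<epsilon> - v)) \<le> r \<epsilon>)" for \<epsilon>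
  have v: "\<forall>\<^sub>F \<epsilon> in at_right 0. v \<epsilon> \<in> D \<epsilon> \<and> ennreal (p (N \<epsilon>) (u \<epsilon> - v \<epsilon>)) \<le> r \<epsilon>"
    using u ex
  proof eventually_elim
    case (elim \<epsilon>)
    then have "\<exists>v. v \<in> D \<epsilon> \<and> ennreal (p (N \<epsilon>) (u \<epsilon> - v)) \<le> r \<epsilon>" by blast
    then show ?case unfolding v_def by (rule someI_ex)
  qed
  have "negligible_net p (\<lambda>\<epsilon>. u \<epsilon> - v \<epsilon>)"
    unfolding negligible_net_iff
  proof (intro allI)
    fix n m
    show "\<forall>\<^sub>F \<epsilon> in at_right 0. p n (u \<epsilon> - v \<epsilon>) \<le> \<epsilon> ^ m"
      using v eventually_le_along_index[OF inc N r, of n m] by eventually_elim blast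
  qed
  then have "v \<in> U" by (rule colombeau_memI[OF sn U])
  moreover have "\<forall>\<^sub>F \<epsilon> in at_right 0. v \<epsilon> \<in> D \<epsilon>"
    using v by eventually_elim blast
  ultimately show "U \<in> internal_set p D"
    using U(1) by (auto simp: mem_internal_set_iff)
qed

text \<open>
  The infimum in the distance need not be attained, and it is infinite over the empty set; any
  positive slack over a finite bound provides a nearby point.
\<close>

lemma seminorm_dist_approx:
  assumes "seminorm_dist p n u C \<le> d" "d < \<infinity>" "0 < t"
  obtains v where "v \<in> C" "ennreal (p n (u - v)) \<le> d + t"
proof -
  have "d < d + t"
    using assms(2,3) ennreal_add_left_cancel_less[of d 0 t] by simp
  with assms(1) have "seminorm_dist p n u C < d + t" by order
  then show ?thesis
    using that by (auto simp: seminorm_dist_def INF_less_iff intro: less_imp_le)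
qed

section \<open>Inclusion and excess\<close>

text \<open>
  Whether or not the excess is attained, one net \<open>u\<close> in \<open>A\<close> detects it: \<open>u\<^sub>\<epsilon>\<close> is a point violating
  the bound \<open>\<epsilon>\<^sup>m\<close> if there is one.
\<close>

lemma negligible_excess_if_internal_subset:
  assumes sn: "\<And>i. seminorm (p i)"
    and bd: "sharply_bounded p A" and ne: "internal_set p A \<noteq> {}"
    and sub: "internal_set p A \<subseteq> internal_set p B"
  shows "negligible_scalar (\<lambda>\<epsilon>. enn2ereal (excess p A B n \<epsilon>))"
  unfolding negligible_scalar_enn2ereal_iff
proof
  fix m
  define bad where "bad \<epsilon> a \<longleftrightarrow> a \<in> A \<epsilon> \<and> \<not> seminorm_dist p n a (B \<epsilon>) \<le> ennreal (\<epsilon> ^ m)" for \<epsilon> a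
  define u where "u \<epsilon> = (if \<exists>a. bad \<epsilon> a then SOME a. bad \<epsilon> a else SOME a. a \<in> A \<epsilon>)" for \<epsilon>
  have bad_u: "bad \<epsilon> (u \<epsilon>)" if "bad \<epsilon> a" for \<epsilon> a
    using that unfolding u_def by (auto intro: someI)
  obtain w where "\<forall>\<^sub>F \<epsilon> in at_right 0. w \<epsilon> \<in> A \<epsilon>"
    using ne by (auto simp: mem_internal_set_iff)
  then have u: "\<forall>\<^sub>F \<epsilon> in at_right 0. u \<epsilon> \<in> A \<epsilon>"
  proof eventually_elim
    case (elim \<epsilon>)
    show ?case
    proof (cases "\<exists>a. bad \<epsilon> a")
      case True
      then show ?thesis using bad_u bad_def by blast
    next
      case False
      then show ?thesis using elim by (auto simp: u_def intro: someI)
    qed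
  qed
  have mod: "moderate p u"
    by (rule moderate_if_in_sharply_bounded[OF bd u])
  with u have "colombeau_rel p `` {u} \<in> internal_set p A"
    using moderate_class[OF sn mod] by (auto simp: mem_internal_set_iff)
  with sub have "colombeau_rel p `` {u} \<in> internal_set p B" by blast
  then obtain v where v: "(u, v) \<in> colombeau_rel p" "\<forall>\<^sub>F \<epsilon> in at_right 0. v \<epsilon> \<in> B \<epsilon>"
    by (auto simp: mem_internal_set_iff)
  then have "\<forall>\<^sub>F \<epsilon> in at_right 0. p n (u \<epsilon> - v \<epsilon>) \<le> \<epsilon> ^ m"
    by (simp add: colombeau_rel_def negligible_net_iff)
  with v(2) show "\<forall>\<^sub>F \<epsilon> in at_right 0. excess p A B n \<epsilon> \<le> ennreal (\<epsilon> ^ m)"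
  proof eventually_elim
    case (elim \<epsilon>)
    have "seminorm_dist p n (u \<epsilon>) (B \<epsilon>) \<le> ennreal (p n (u \<epsilon> - v \<epsilon>))"
      unfolding seminorm_dist_def using elim(1) by (rule INF_lower)
    also have "\<dots> \<le> ennreal (\<epsilon> ^ m)" using elim(2) by (rule ennreal_leI)
    finally have "\<not> bad \<epsilon> (u \<epsilon>)" by (simp add: bad_def)
    with bad_u have "\<not> bad \<epsilon> a" for a by blast
    then show ?case by (auto simp: excess_def bad_def intro: SUP_least)
  qed
qed

text \<open>
  This supplies the finiteness that \<open>seminorm_dist_approx\<close> asks for: adding slack to an
  infinite bound gains nothing.
\<close>

lemma eventually_finite_if_negligible:
  assumes "negligible_scalar (\<lambda>\<epsilon>. enn2ereal (x \<epsilon>))"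
  shows "\<forall>\<^sub>F \<epsilon> in at_right 0. x \<epsilon> < \<infinity>"
proof -
  have "\<forall>\<^sub>F \<epsilon> in at_right 0. x \<epsilon> \<le> ennreal (\<epsilon> ^ 0)"
    using assms unfolding negligible_scalar_enn2ereal_iff by blast
  then show ?thesis
    by eventually_elim (simp add: le_less_trans)
qed

lemma seminorm_dist_le_excess:
  "u \<in> A \<epsilon> \<Longrightarrow> seminorm_dist p n u (B \<epsilon>) \<le> excess p A B n \<epsilon>"
  unfolding excess_def by (rule SUP_upper)

text \<open>
  The positive slack \<open>\<nu>\<close> makes the tolerance exceed the excess strictly. Where the excess is finite,
  each point of \<open>A\<close> therefore has a point of \<open>B\<close> within the tolerance, and that point belongs to the
  near part by symmetry of the distance.
\<close>

definition near_part ::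
    "(nat \<Rightarrow> 'a::real_vector \<Rightarrow> real) \<Rightarrow> nat net \<Rightarrow> real net \<Rightarrow> 'a set net \<Rightarrow> 'a set net \<Rightarrow> 'a set net" where
  "near_part p N \<nu> A B =
    (\<lambda>\<epsilon>. {u. seminorm_dist p (N \<epsilon>) u (A \<epsilon>) \<le> excess p A B (N \<epsilon>) \<epsilon> + ennreal (\<nu> \<epsilon>)} \<inter> B \<epsilon>)"

context
  fixes p :: "nat \<Rightarrow> 'a::real_vector \<Rightarrow> real" and A B :: "'a set net"
    and N :: "nat net" and \<nu> :: "real net"
  assumes sn: "\<And>n. seminorm (p n)" and inc: "incseq p"
    and N: "filterlim N at_top (at_right 0)"
    and \<delta>: "negligible_scalar (\<lambda>\<epsilon>. enn2ereal (excess p A B (N \<epsilon>) \<epsilon>))"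
    and \<nu>: "negligible_scalar (\<lambda>\<epsilon>. ereal (\<nu> \<epsilon>))" "\<And>\<epsilon>. \<epsilon> \<in> {0<..<1} \<Longrightarrow> 0 < \<nu> \<epsilon>"
begin

lemma slack_negligible:
  "negligible_scalar (\<lambda>\<epsilon>. enn2ereal (excess p A B (N \<epsilon>) \<epsilon> + ennreal (\<nu> \<epsilon>)))"
  using \<delta> negligible_scalar_ennreal[OF \<nu>(1)] by (rule negligible_scalar_add)

lemma double_slack_negligible:
  "negligible_scalar (\<lambda>\<epsilon>. enn2ereal (excess p A B (N \<epsilon>) \<epsilon> + ennreal (\<nu> \<epsilon>) + ennreal (\<nu> \<epsilon>)))"
  using slack_negligible negligible_scalar_ennreal[OF \<nu>(1)] by (rule negligible_scalar_add)

lemma slack_pos: "\<forall>\<^sub>F \<epsilon> in at_right 0. 0 < ennreal (\<nu> \<epsilon>)"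
  using eventually_small[of 1] by (rule eventually_mono) (use \<nu>(2) in auto)

lemma near_part_approximates:
  "\<forall>\<^sub>F \<epsilon> in at_right 0. \<forall>u\<in>A \<epsilon>. \<exists>v\<in>near_part p N \<nu> A B \<epsilon>.
     ennreal (p (N \<epsilon>) (u - v)) \<le> excess p A B (N \<epsilon>) \<epsilon> + ennreal (\<nu> \<epsilon>)"
  using slack_pos eventually_finite_if_negligible[OF \<delta>]
proof eventually_elim
  case (elim \<epsilon>)
  show ?case
  proof
    fix u
    assume u: "u \<in> A \<epsilon>"
    obtain v where v: "v \<in> B \<epsilon>"
        "ennreal (p (N \<epsilon>) (u - v)) \<le> excess p A B (N \<epsilon>) \<epsilon> + ennreal (\<nu> \<epsilon>)"
      using seminorm_dist_approx[OF seminorm_dist_le_excess[of u A \<epsilon>, OF u] elim(2,1)] .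
    have "seminorm_dist p (N \<epsilon>) v (A \<epsilon>) \<le> ennreal (p (N \<epsilon>) (v - u))"
      unfolding seminorm_dist_def using u by (rule INF_lower)
    with v(2) have "seminorm_dist p (N \<epsilon>) v (A \<epsilon>) \<le> excess p A B (N \<epsilon>) \<epsilon> + ennreal (\<nu> \<epsilon>)"
      by (simp add: seminorm_minus_commute[OF sn, of _ v u])
    with v show "\<exists>v\<in>near_part p N \<nu> A B \<epsilon>.
        ennreal (p (N \<epsilon>) (u - v)) \<le> excess p A B (N \<epsilon>) \<epsilon> + ennreal (\<nu> \<epsilon>)"
      by (auto simp: near_part_def)
  qed
qed

text \<open>The second \<open>\<nu>\<close> pays for the infimum in the distance to \<open>A\<close>, which need not be attained.\<close>

lemma near_part_approximated:
  "\<forall>\<^sub>F \<epsilon> in at_right 0. \<forall>v\<in>near_part p N \<nu> A B \<epsilon>. \<exists>u\<in>A \<epsilon>.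
     ennreal (p (N \<epsilon>) (v - u)) \<le> excess p A B (N \<epsilon>) \<epsilon> + ennreal (\<nu> \<epsilon>) + ennreal (\<nu> \<epsilon>)"
  using slack_pos eventually_finite_if_negligible[OF slack_negligible]
proof eventually_elim
  case (elim \<epsilon>)
  show ?case
  proof
    fix v
    assume "v \<in> near_part p N \<nu> A B \<epsilon>"
    then have "seminorm_dist p (N \<epsilon>) v (A \<epsilon>) \<le> excess p A B (N \<epsilon>) \<epsilon> + ennreal (\<nu> \<epsilon>)"
      by (simp add: near_part_def)
    from seminorm_dist_approx[OF this elim(2,1)]
    show "\<exists>u\<in>A \<epsilon>. ennreal (p (N \<epsilon>) (v - u))
        \<le> excess p A B (N \<epsilon>) \<epsilon> + ennreal (\<nu> \<epsilon>) + ennreal (\<nu> \<epsilon>)"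
      by blast
  qed
qed

lemma internal_set_near_part: "internal_set p (near_part p N \<nu> A B) = internal_set p A"
  using internal_set_mono_approx[OF sn inc N slack_negligible near_part_approximates]
    internal_set_mono_approx[OF sn inc N double_slack_negligible near_part_approximated]
  by blast

lemma sharply_bounded_near_part:
  assumes "sharply_bounded p A"
  shows "sharply_bounded p (near_part p N \<nu> A B)"
  unfolding sharply_bounded_iff
proof
  fix n
  obtain M where "\<forall>\<^sub>F \<epsilon> in at_right 0. \<forall>u\<in>A \<epsilon>. p n u \<le> \<epsilon> powi (- int M)"
    using assms unfolding sharply_bounded_iff by blast
  moreover have "\<forall>\<^sub>F \<epsilon> in at_right (0::real). 0 < \<epsilon> \<and> \<epsilon> < 1/2"
    by (rule eventually_small) simp
  ultimately have "\<forall>\<^sub>F \<epsilon> in at_right 0. \<forall>v\<in>near_part p N \<nu> A B \<epsilon>. p n v \<le> \<epsilon> powi (- int (Suc M))"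
    using near_part_approximated
      eventually_le_along_index[OF inc N double_slack_negligible, of n 0]
  proof eventually_elim
    case (elim \<epsilon>)
    show ?case
    proof
      fix v
      assume "v \<in> near_part p N \<nu> A B \<epsilon>"
      with elim(3) obtain u where u: "u \<in> A \<epsilon>"
        "ennreal (p (N \<epsilon>) (v - u)) \<le> excess p A B (N \<epsilon>) \<epsilon> + ennreal (\<nu> \<epsilon>) + ennreal (\<nu> \<epsilon>)"
        by blast
      have "p n v \<le> p n u + p n (v - u)"
        using seminorm_triangle[OF sn, of n u "v - u"] by simp
      also have "\<dots> \<le> \<epsilon> powi (- int M) + 1"
        using elim(1,4) u by (intro add_mono) auto
      also have "\<dots> \<le> \<epsilon> powi (- int (Suc M))"
        using elim(2) by (intro powi_add_one_le) auto
      finally show "p n v \<le> \<epsilon> powi (- int (Suc M))" .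
    qed
  qed
  then show "\<exists>M. \<forall>\<^sub>F \<epsilon> in at_right 0. \<forall>v\<in>near_part p N \<nu> A B \<epsilon>. p n v \<le> \<epsilon> powi (- int M)" ..
qed

text \<open>
  A negligible excess along one index tending to infinity already forces the inclusion, since the
  points of the near part that approximate \<open>A\<close> lie in \<open>B\<close>.
\<close>

lemma internal_set_subset_if_excess_negligible: "internal_set p A \<subseteq> internal_set p B"
proof -
  have "\<forall>\<^sub>F \<epsilon> in at_right 0. \<forall>u\<in>A \<epsilon>. \<exists>v\<in>B \<epsilon>.
      ennreal (p (N \<epsilon>) (u - v)) \<le> excess p A B (N \<epsilon>) \<epsilon> + ennreal (\<nu> \<epsilon>)"
    using near_part_approximates by eventually_elim (fastforce simp: near_part_def)
  then show ?thesis
    by (rule internal_set_mono_approx[OF sn inc N slack_negligible])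
qed

end

theorem theorem3p8:
  fixes p :: "nat \<Rightarrow> 'a::real_vector \<Rightarrow> real"
    and \<A> \<B> :: "'a net set set"
    and A B :: "'a set net"
  assumes "\<And>n. seminorm (p n)"
    and "incseq p"
    and "internal p \<A>" and "\<A> \<noteq> {}"
    and "sharply_bounded p A" and "\<A> = internal_set p A"
    and "internal p \<B>" and "\<B> = internal_set p B"
  shows "(\<A> \<subseteq> \<B> \<longleftrightarrow> (\<forall>n. negligible_scalar (\<lambda>\<epsilon>. enn2ereal (excess p A B n \<epsilon>))))
    \<and> (\<A> \<subseteq> \<B> \<longrightarrow>
        (\<exists>N :: nat net.
           filterlim N at_top (at_right 0)
         \<and> negligible_scalar (\<lambda>\<epsilon>. enn2ereal (excess p A B (N \<epsilon>) \<epsilon>))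
         \<and> (\<forall>\<nu> :: real net.
              negligible_scalar (\<lambda>\<epsilon>. ereal (\<nu> \<epsilon>)) \<and> (\<forall>\<epsilon>\<in>{0<..<1}. 0 < \<nu> \<epsilon>) \<longrightarrow>
              \<A> = internal_set p
                    (\<lambda>\<epsilon>. {u. seminorm_dist p (N \<epsilon>) u (A \<epsilon>) \<le> excess p A B (N \<epsilon>) \<epsilon> + ennreal (\<nu> \<epsilon>)}
                         \<inter> B \<epsilon>))))
    \<and> (\<A> \<subseteq> \<B> \<longrightarrow>
        (\<exists>A'. sharply_bounded p A' \<and> \<A> = internal_set p A' \<and> (\<forall>\<epsilon>\<in>{0<..<1}. A' \<epsilon> \<subseteq> B \<epsilon>)))"
proof -
  have fwd: "\<forall>n. negligible_scalar (\<lambda>\<epsilon>. enn2ereal (excess p A B n \<epsilon>))" if "\<A> \<subseteq> \<B>"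
    using negligible_excess_if_internal_subset[OF assms(1,5)] assms(4,6,8) that by blast
  have bwd: "\<A> \<subseteq> \<B>" if small: "\<forall>n. negligible_scalar (\<lambda>\<epsilon>. enn2ereal (excess p A B n \<epsilon>))"
  proof -
    obtain N :: "nat net" where N: "filterlim N at_top (at_right 0)"
      "negligible_scalar (\<lambda>\<epsilon>. enn2ereal (excess p A B (N \<epsilon>) \<epsilon>))"
      using ex_diagonal_index[of "excess p A B"] small by blast
    \<comment> \<open>any positive negligible slack will do; \<open>\<epsilon>\<^sup>N\<close> at the diagonal index is one\<close>
    show ?thesis
      unfolding assms(6,8)
      by (rule internal_set_subset_if_excess_negligible
          [OF assms(1,2) N negligible_scalar_power_index[OF N(1)]]) simp
  qed
  have "\<exists>N :: nat net. filterlim N at_top (at_right 0)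
         \<and> negligible_scalar (\<lambda>\<epsilon>. enn2ereal (excess p A B (N \<epsilon>) \<epsilon>))
         \<and> (\<forall>\<nu> :: real net.
              negligible_scalar (\<lambda>\<epsilon>. ereal (\<nu> \<epsilon>)) \<and> (\<forall>\<epsilon>\<in>{0<..<1}. 0 < \<nu> \<epsilon>) \<longrightarrow>
              \<A> = internal_set p (near_part p N \<nu> A B))
         \<and> (\<exists>A'. sharply_bounded p A' \<and> \<A> = internal_set p A' \<and> (\<forall>\<epsilon>\<in>{0<..<1}. A' \<epsilon> \<subseteq> B \<epsilon>))"
    if sub: "\<A> \<subseteq> \<B>"
  proof -
    obtain N :: "nat net" where N: "filterlim N at_top (at_right 0)"
      "negligible_scalar (\<lambda>\<epsilon>. enn2ereal (excess p A B (N \<epsilon>) \<epsilon>))"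
      using ex_diagonal_index[of "excess p A B"] fwd[OF sub] by blast
    have eq: "\<A> = internal_set p (near_part p N \<nu> A B)"
      if "negligible_scalar (\<lambda>\<epsilon>. ereal (\<nu> \<epsilon>))" "\<forall>\<epsilon>\<in>{0<..<1}. 0 < \<nu> \<epsilon>" for \<nu>
      using internal_set_near_part[OF assms(1,2) N, of \<nu>] that assms(6) by simp
    let ?A' = "near_part p N (\<lambda>\<epsilon>. \<epsilon> ^ N \<epsilon>) A B"
    note pow = negligible_scalar_power_index[OF N(1)]
    have "sharply_bounded p ?A'"
      by (rule sharply_bounded_near_part[OF assms(1,2) N pow _ assms(5)]) simp
    moreover have "\<A> = internal_set p ?A'"
      by (rule eq[OF pow]) simp
    moreover have "\<forall>\<epsilon>\<in>{0<..<1}. ?A' \<epsilon> \<subseteq> B \<epsilon>"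
      by (auto simp: near_part_def)
    ultimately show ?thesis using N eq by blast
  qed
  then show ?thesis
    unfolding near_part_def using fwd bwd by blast
qed

end
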